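(* Let $k \geq 3$ be a fixed integer, let $\mathcal{H}$ be a family of graphs, and let $g := g(\mathcal{H},k)$ (assumed finite). For each $n$ let $G = G_n$ be an $\mathcal{H}$-free $n$-vertex graph with maximum degree $\Delta := \Delta(n)$, and let $m := m(n)$ be a positive integer. If $m / \left(n^{2/(k(g+1))} \Delta^{2g/(k(g+1))}\right) \to \infty$ as $n \to \infty$ and $m \geq 3k^2\Delta$, then $G$ is a.a.s. $(k,m)$-colourable.
   Context: Given positive integers $k \leq m$ and a graph $G$, a random $(k,m)$-list-assignment $\mathcal{L} = \{L(v) : v \in V(G)\}$ assigns to each vertex $v$ a $k$-element subset $L(v)$ of $\{1,\ldots,m\}$ chosen uniformly at random, independently over vertices. $G$ is $\mathcal{L}$-colourable if there is a proper colouring $c$ with $c(v) \in L(v)$ for all $v$. An $n$-vertex graph $G$ is a.a.s. $(k,m)$-colourable if $\lim_{n\to\infty}\mathbb{P}(G \text{ is } \mathcal{L}\text{-colourable}) = 1$. A graph is $\mathcal{H}$-free if no $H \in \mathcal{H}$ is a (not necessarily induced) subgraph of it. A graph is $k$-choosable if it is $\mathcal{L}$-colourable for every assignment of lists of size $k$. For a positive integer $k$ and family $\mathcal{H}$, $g(\mathcal{H},k)$ is the largest integer $g$ such that every $\mathcal{H}$-free graph on at most $g$ vertices is $k$-choosable. *)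

theory Defs
  imports "HOL-Probability.Probability"
begin

type_synonym graph = "nat set \<times> nat set set"

definition sgraph :: "graph \<Rightarrow> bool" where
  "sgraph G \<longleftrightarrow> finite (fst G) \<and>
     (\<forall>e\<in>snd G. \<exists>u v. u \<in> fst G \<and> v \<in> fst G \<and> u \<noteq> v \<and> e = {u, v})"

definition contains_subgraph :: "graph \<Rightarrow> graph \<Rightarrow> bool" where
  "contains_subgraph G H \<longleftrightarrow>
     (\<exists>f. inj_on f (fst H) \<and> f ` fst H \<subseteq> fst G \<and> (\<forall>e\<in>snd H. f ` e \<in> snd G))"

definition H_free :: "graph set \<Rightarrow> graph \<Rightarrow> bool" where
  "H_free \<H> G \<longleftrightarrow> (\<forall>H\<in>\<H>. \<not> contains_subgraph G H)"

definition proper_colouring :: "graph \<Rightarrow> (nat \<Rightarrow> nat) \<Rightarrow> bool" where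
  "proper_colouring G c \<longleftrightarrow> (\<forall>u v. {u, v} \<in> snd G \<longrightarrow> u \<noteq> v \<longrightarrow> c u \<noteq> c v)"

definition L_colourable :: "graph \<Rightarrow> (nat \<Rightarrow> nat set) \<Rightarrow> bool" where
  "L_colourable G L \<longleftrightarrow> (\<exists>c. proper_colouring G c \<and> (\<forall>v\<in>fst G. c v \<in> L v))"

definition k_choosable :: "graph \<Rightarrow> nat \<Rightarrow> bool" where
  "k_choosable G k \<longleftrightarrow> (\<forall>L. (\<forall>v\<in>fst G. card (L v) = k) \<longrightarrow> L_colourable G L)"

definition good_bound :: "graph set \<Rightarrow> nat \<Rightarrow> nat \<Rightarrow> bool" where
  "good_bound \<H> k g \<longleftrightarrow>
     (\<forall>G. sgraph G \<and> H_free \<H> G \<and> card (fst G) \<le> g \<longrightarrow> k_choosable G k)"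

definition is_g :: "graph set \<Rightarrow> nat \<Rightarrow> nat \<Rightarrow> bool" where
  "is_g \<H> k g \<longleftrightarrow> good_bound \<H> k g \<and> (\<forall>g'. good_bound \<H> k g' \<longrightarrow> g' \<le> g)"

definition degree :: "graph \<Rightarrow> nat \<Rightarrow> nat" where
  "degree G v = card {u. {u, v} \<in> snd G}"

definition max_degree :: "graph \<Rightarrow> nat" where
  "max_degree G = (if fst G = {} then 0 else Max (degree G ` fst G))"

definition random_lists :: "graph \<Rightarrow> nat \<Rightarrow> nat \<Rightarrow> (nat \<Rightarrow> nat set) pmf" where
  "random_lists G k m =
     Pi_pmf (fst G) {} (\<lambda>_. pmf_of_set {S. S \<subseteq> {1..m} \<and> card S = k})"

definition prob_colourable :: "graph \<Rightarrow> nat \<Rightarrow> nat \<Rightarrow> real" where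
  "prob_colourable G k m = measure_pmf.prob (random_lists G k m) {L. L_colourable G L}"

text \<open>x^a with the convention 0^0 = 1 (real exponent).\<close>
definition rpow :: "real \<Rightarrow> real \<Rightarrow> real" where
  "rpow x a = (if a = 0 then 1 else x powr a)"

end

theory Submission
  imports Defs "HOL-Real_Asymp.Real_Asymp"
begin

text \<open>
  Call an edge of \<open>G\<close> conflicting if the lists of its ends meet.  A minimal uncolourable vertex set
  \<open>S\<close> is connected by conflicting edges, has more than \<open>g\<close> vertices, and every colour in the list of
  a vertex of \<open>S\<close> reappears at a neighbour in \<open>S\<close>, so the lists on \<open>S\<close> use at most \<open>k |S| / 2\<close>
  colours.  For a cutoff \<open>M\<close> of order \<open>(ln n)\<^sup>2\<close> take a union bound over two events.
  If \<open>|S| > M\<close>, there is a tree of \<open>M\<close> conflicting edges; there are at most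
  \<open>n (e \<Delta>)\<^sup>M\<close> such trees up to a constant, each conflicting with probability at most
  \<open>(k\<^sup>2 / m)\<^sup>M\<close>, and \<open>e \<Delta> k\<^sup>2 / m \<le> e / 3 < 1\<close>.
  If \<open>|S| = N \<le> M\<close>, the set \<open>S\<close> is spanned by one of roughly \<open>n (N \<Delta>) ^ (N - 1)\<close> trees and the
  lists on it use few colours with probability at most \<open>(k N) ^ (k N) m powr (-k N / 2)\<close>.  The term
  \<open>N = g + 1\<close> is of order \<open>n \<Delta> ^ g m powr (-k (g + 1) / 2)\<close>, which vanishes by the growth
  assumption on \<open>m\<close>, and it dominates the sum.
\<close>

section \<open>Enumerating rooted trees\<close>

text \<open>A rooted tree is stored as the list of its (parent, child) edges in the order of discovery;
  in both functions, \<open>X\<close> is the set of vertices discovered so far.\<close>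

fun attached :: "nat set \<Rightarrow> (nat \<times> nat) list \<Rightarrow> bool" where
  "attached X [] = True"
| "attached X ((a, u) # T) \<longleftrightarrow> a \<in> X \<and> u \<notin> X \<and> attached (insert u X) T"

text \<open>\<open>E\<close> lists the pending edges: each of them is either discarded or taken into the tree, in which
  case the edges at its child become pending.  With at most \<open>d\<close> neighbours per vertex, this is
  Pascal's recurrence for the binomial coefficient in \<open>card_grow\<close>.\<close>

fun grow :: "(nat \<Rightarrow> nat list) \<Rightarrow> nat \<Rightarrow> nat set \<Rightarrow> (nat \<times> nat) list \<Rightarrow> (nat \<times> nat) list set" where
  "grow nb 0 X E = {[]}"
| "grow nb (Suc r) X [] = {}"
| "grow nb (Suc r) X ((a, u) # E) = grow nb (Suc r) X E \<union>
     (if u \<in> X then {}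
      else (#) (a, u) ` grow nb r (insert u X) (map (Pair u) (nb u) @ E))"

lemma attached_snoc:
  "attached X (T @ [(a, u)]) \<longleftrightarrow>
     attached X T \<and> a \<in> X \<union> snd ` set T \<and> u \<notin> X \<union> snd ` set T"
  by (induction X T rule: attached.induct) auto

lemma attached_parents: "attached X T \<Longrightarrow> fst ` set T \<subseteq> X \<union> snd ` set T"
  by (induction X T rule: attached.induct) auto

lemma attached_children:
  "attached X T \<Longrightarrow> X \<inter> snd ` set T = {} \<and> card (snd ` set T) = length T"
  by (induction X T rule: attached.induct) auto

lemma length_grow: "T \<in> grow nb r X E \<Longrightarrow> length T = r"
  by (induction nb r X E arbitrary: T rule: grow.induct) (auto split: if_splits)

lemma attached_grow: "T \<in> grow nb r X E \<Longrightarrow> fst ` set E \<subseteq> X \<Longrightarrow> attached X T"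
proof (induction nb r X E arbitrary: T rule: grow.induct)
  case (3 nb r X a u E)
  have sub: "fst ` set (map (Pair u) (nb u) @ E) \<subseteq> insert u X" using "3.prems" by auto
  show ?case
  proof (cases "T \<in> grow nb (Suc r) X E")
    case True
    then show ?thesis using 3 by auto
  next
    case False
    then obtain T' where "u \<notin> X" "T = (a, u) # T'"
        "T' \<in> grow nb r (insert u X) (map (Pair u) (nb u) @ E)"
      using "3.prems" by (auto split: if_splits)
    then show ?thesis using "3.IH"(2)[of T'] sub "3.prems" by auto
  qed
qed auto

lemma grow_children_subset:
  assumes "\<And>u. set (nb u) \<subseteq> A"
  shows "T \<in> grow nb r X E \<Longrightarrow> snd ` set E \<subseteq> A \<Longrightarrow> snd ` set T \<subseteq> A"
proof (induction nb\<equiv>nb r X E arbitrary: T rule: grow.induct)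
  case (3 r X a u E)
  have sub: "snd ` set (map (Pair u) (nb u) @ E) \<subseteq> A" using "3.prems" assms[of u] by auto
  show ?case
  proof (cases "T \<in> grow nb (Suc r) X E")
    case True
    then show ?thesis using 3 by auto
  next
    case False
    then obtain T' where "u \<notin> X" "T = (a, u) # T'"
        "T' \<in> grow nb r (insert u X) (map (Pair u) (nb u) @ E)"
      using "3.prems" by (auto split: if_splits)
    then show ?thesis using "3.hyps"(2)[of T'] sub "3.prems" by auto
  qed
qed auto

lemma card_grow:
  assumes "\<And>u. length (nb u) \<le> d"
  shows "finite (grow nb r X E) \<and> card (grow nb r X E) \<le> (length E + d * r) choose r"
proof (induction nb\<equiv>nb r X E rule: grow.induct)
  case (3 r X a u E)
  let ?A = "grow nb (Suc r) X E" and ?B = "grow nb r (insert u X) (map (Pair u) (nb u) @ E)"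
  let ?C = "if u \<in> X then {} else (#) (a, u) ` ?B"
  have C: "finite ?C \<and> card ?C \<le> (length E + d * Suc r) choose r"
  proof (cases "u \<in> X")
    case False
    have "card ?C \<le> card ?B" using False 3(2) by (auto intro: card_image_le)
    also have "\<dots> \<le> (length (map (Pair u) (nb u) @ E) + d * r) choose r" using 3(2) False by blast
    \<comment> \<open>Accepting the edge trades one of the \<open>Suc r\<close> open places for at
      most \<open>d\<close> new pending edges, so the upper index is the same as after a
      rejection.\<close>
    also have "\<dots> \<le> (length E + d * Suc r) choose r"
      using assms[of u] by (intro binomial_right_mono) auto
    finally show ?thesis using False 3(2) by auto
  qed auto
  have "card (?A \<union> ?C) \<le> card ?A + card ?C" by (rule card_Un_le)
  also have "\<dots> \<le> ((length E + d * Suc r) choose (Suc r)) + ((length E + d * Suc r) choose r)"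
    by (rule add_mono[OF conjunct2[OF 3(1)] conjunct2[OF C]])
  also have "\<dots> = (length ((a, u) # E) + d * Suc r) choose (Suc r)" by simp
  finally show ?case using 3(1) C by (simp only: grow.simps finite_Un)
qed auto

text \<open>Invariant: every \<open>R\<close>-edge from \<open>X\<close> to the rest of
  \<open>W\<close> is pending. Taking a pending edge exactly when it is an \<open>R\<close>-edge
  into \<open>W - X\<close> preserves this, and connectivity of \<open>W\<close> keeps the pending
  list from running out before \<open>r\<close> edges are taken.\<close>

lemma grow_exists:
  assumes W: "finite W"
    and conn: "\<And>Y. Y \<subset> W \<Longrightarrow> Y \<noteq> {} \<Longrightarrow> \<exists>a\<in>Y. \<exists>b\<in>W - Y. R a b"
    and nb: "\<And>a b. R a b \<Longrightarrow> b \<in> set (nb a)"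
  shows "X \<subseteq> W \<Longrightarrow> X \<noteq> {} \<Longrightarrow> card X + r \<le> card W \<Longrightarrow>
    (\<forall>a\<in>X. \<forall>b\<in>W - X. R a b \<longrightarrow> (a, b) \<in> set E) \<Longrightarrow> fst ` set E \<subseteq> X \<Longrightarrow>
    \<exists>T\<in>grow nb r X E. (\<forall>(a, u)\<in>set T. R a u) \<and> snd ` set T \<subseteq> W"
proof (induction nb\<equiv>nb r X E rule: grow.induct)
  case (2 r X)
  then have "X \<noteq> W" by auto
  then show ?case using conn[of X] 2 by auto
next
  case (3 r X a u E)
  show ?case
  proof (cases "u \<in> W - X \<and> R a u")
    case True
    let ?E = "map (Pair u) (nb u) @ E"
    have "finite X" using "3.prems" W finite_subset by blast
    then have "\<exists>T\<in>grow nb r (insert u X) ?E. (\<forall>(a, u)\<in>set T. R a u) \<and> snd ` set T \<subseteq> W"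
      using "3.prems" True nb by (intro "3.hyps"(2)) auto
    then obtain T where "T \<in> grow nb r (insert u X) ?E" "\<forall>(a, u)\<in>set T. R a u" "snd ` set T \<subseteq> W"
      by blast
    then show ?thesis using True by (intro bexI[of _ "(a, u) # T"]) auto
  next
    case False
    then have "\<exists>T\<in>grow nb (Suc r) X E. (\<forall>(a, u)\<in>set T. R a u) \<and> snd ` set T \<subseteq> W"
      using "3.prems" by (intro "3.hyps"(1)) auto
    then show ?thesis by auto
  qed
qed auto

section \<open>Minimal uncolourable vertex sets\<close>

definition colourable_on :: "graph \<Rightarrow> (nat \<Rightarrow> nat set) \<Rightarrow> nat set \<Rightarrow> bool" where
  "colourable_on G L S \<longleftrightarrow> (\<exists>c. (\<forall>u\<in>S. \<forall>v\<in>S. {u, v} \<in> snd G \<longrightarrow> u \<noteq> v \<longrightarrow> c u \<noteq> c v) \<and>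
     (\<forall>v\<in>S. c v \<in> L v))"

definition conflict :: "graph \<Rightarrow> (nat \<Rightarrow> nat set) \<Rightarrow> nat \<Rightarrow> nat \<Rightarrow> bool" where
  "conflict G L a b \<longleftrightarrow> {a, b} \<in> snd G \<and> a \<noteq> b \<and> L a \<inter> L b \<noteq> {}"

lemma colourable_on_fst:
  assumes "sgraph G" "colourable_on G L (fst G)"
  shows "L_colourable G L"
proof -
  obtain c where c: "\<forall>u\<in>fst G. \<forall>v\<in>fst G. {u, v} \<in> snd G \<longrightarrow> u \<noteq> v \<longrightarrow> c u \<noteq> c v"
      "\<forall>v\<in>fst G. c v \<in> L v"
    using assms(2) unfolding colourable_on_def by blast
  have "u \<in> fst G \<and> v \<in> fst G" if "{u, v} \<in> snd G" for u v
    using assms(1) that unfolding sgraph_def by (metis doubleton_eq_iff)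
  then show ?thesis using c unfolding L_colourable_def proper_colouring_def by blast
qed

text \<open>The subgraph induced on \<open>S\<close> inherits \<open>\<H>\<close>-freeness and has
  at most \<open>g\<close> vertices, so \<open>good_bound\<close> makes it
  \<open>k\<close>-choosable.\<close>

lemma colourable_on_small:
  assumes "sgraph G" "H_free \<H> G" "good_bound \<H> k g" "S \<subseteq> fst G" "card S \<le> g"
    "\<And>v. v \<in> fst G \<Longrightarrow> card (L v) = k"
  shows "colourable_on G L S"
proof -
  let ?H = "(S, {e \<in> snd G. e \<subseteq> S})"
  have 1: "sgraph ?H"
  proof -
    have "finite S" using assms(1,4) finite_subset unfolding sgraph_def by auto
    moreover have "\<exists>u v. u \<in> S \<and> v \<in> S \<and> u \<noteq> v \<and> e = {u, v}" if "e \<in> snd G" "e \<subseteq> S" for e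
      using assms(1) that unfolding sgraph_def by (metis insert_subset)
    ultimately show ?thesis unfolding sgraph_def by auto
  qed
  have 2: "H_free \<H> ?H"
    using assms(2,4) unfolding H_free_def contains_subgraph_def by fastforce
  have "k_choosable ?H k" using assms(3,5) 1 2 unfolding good_bound_def by auto
  then have "L_colourable ?H L" using assms(4,6) unfolding k_choosable_def by auto
  then show ?thesis unfolding L_colourable_def proper_colouring_def colourable_on_def by auto
qed

lemma minimal_uncolourable:
  assumes "sgraph G" "\<not> L_colourable G L"
  obtains S where "S \<subseteq> fst G" "\<not> colourable_on G L S" "\<And>X. X \<subset> S \<Longrightarrow> colourable_on G L X"
proof -
  have fin: "finite (fst G)" using assms(1) by (simp add: sgraph_def)
  have "\<exists>S. \<not> colourable_on G L S \<and> S \<subseteq> fst G" using colourable_on_fst assms by blast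
  then obtain S where S: "\<not> colourable_on G L S \<and> S \<subseteq> fst G"
    and min: "\<And>X. card X < card S \<Longrightarrow> \<not> (\<not> colourable_on G L X \<and> X \<subseteq> fst G)"
    using exists_least_iff[of "\<lambda>n. \<exists>S. (\<not> colourable_on G L S \<and> S \<subseteq> fst G) \<and> card S = n"] by blast
  \<comment> \<open>\<open>S\<close> was chosen with the fewest vertices; since it is finite, it is
    also minimal under inclusion.\<close>
  have "colourable_on G L X" if "X \<subset> S" for X
    using min[of X] S that psubset_card_mono[of S X] finite_subset[OF _ fin] by auto
  then show ?thesis using that S by blast
qed

context
  fixes G :: graph and L :: "nat \<Rightarrow> nat set" and S :: "nat set"
  assumes unc: "\<not> colourable_on G L S"
    and min: "\<And>X. X \<subset> S \<Longrightarrow> colourable_on G L X"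
begin

text \<open>Minimality colours \<open>Y\<close> and \<open>S - Y\<close> separately. If no
  conflicting edge joins them, the two colourings cannot clash across the cut and together colour
  \<open>S\<close>.\<close>

lemma uncolourable_connected:
  assumes "Y \<subset> S" "Y \<noteq> {}"
  shows "\<exists>a\<in>Y. \<exists>b\<in>S - Y. conflict G L a b"
proof (rule ccontr)
  assume no: "\<not> ?thesis"
  obtain c where c: "\<forall>u\<in>Y. \<forall>v\<in>Y. {u, v} \<in> snd G \<longrightarrow> u \<noteq> v \<longrightarrow> c u \<noteq> c v" "\<forall>v\<in>Y. c v \<in> L v"
    using min[OF assms(1)] unfolding colourable_on_def by blast
  have "S - Y \<subset> S" using assms by auto
  from min[OF this] obtain d where
    d: "\<forall>u\<in>S-Y. \<forall>v\<in>S-Y. {u, v} \<in> snd G \<longrightarrow> u \<noteq> v \<longrightarrow> d u \<noteq> d v" "\<forall>v\<in>S-Y. d v \<in> L v"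
    unfolding colourable_on_def by blast
  let ?e = "\<lambda>v. if v \<in> Y then c v else d v"
  have cross: "c u \<noteq> d v" if "u \<in> Y" "v \<in> S - Y" "{u, v} \<in> snd G" for u v
  proof
    assume "c u = d v"
    then have "conflict G L u v" using that c(2) d(2) unfolding conflict_def by auto
    then show False using no that by blast
  qed
  have "?e u \<noteq> ?e v" if uv: "u \<in> S" "v \<in> S" "{u, v} \<in> snd G" "u \<noteq> v" for u v
  proof -
    have vu: "{v, u} \<in> snd G" using uv by (simp add: insert_commute)
    show ?thesis
      using uv c(1) d(1) cross[of u v] cross[of v u] vu
      by (cases "u \<in> Y"; cases "v \<in> Y") (auto dest: not_sym)
  qed
  moreover have "\<forall>v\<in>S. ?e v \<in> L v" using c d by auto
  ultimately have "colourable_on G L S" unfolding colourable_on_def by (intro exI[of _ ?e]) blast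
  then show False using unc by simp
qed

text \<open>Otherwise the colouring of \<open>S - {v}\<close> given by minimality extends to
  \<open>v\<close> with the colour \<open>c\<close>.\<close>

lemma uncolourable_colour_repeated:
  assumes "v \<in> S" "c \<in> L v"
  shows "\<exists>u\<in>S - {v}. c \<in> L u \<and> {u, v} \<in> snd G"
proof (rule ccontr)
  assume no: "\<not> ?thesis"
  have "S - {v} \<subset> S" using assms by auto
  from min[OF this] obtain d where
    d: "\<forall>u\<in>S-{v}. \<forall>w\<in>S-{v}. {u, w} \<in> snd G \<longrightarrow> u \<noteq> w \<longrightarrow> d u \<noteq> d w" "\<forall>w\<in>S-{v}. d w \<in> L w"
    unfolding colourable_on_def by blast
  have cross: "d u \<noteq> c" if "u \<in> S - {v}" "{u, v} \<in> snd G" for u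
    using no that d(2) by metis
  have "(d(v := c)) u \<noteq> (d(v := c)) w" if uv: "u \<in> S" "w \<in> S" "{u, w} \<in> snd G" "u \<noteq> w" for u w
  proof -
    have vu: "{w, u} \<in> snd G" using uv by (simp add: insert_commute)
    show ?thesis
      using uv d(1) cross[of u] cross[of w] vu
      by (cases "u = v"; cases "w = v") (auto dest: not_sym)
  qed
  moreover have "\<forall>w\<in>S. (d(v := c)) w \<in> L w" using d assms by auto
  ultimately have "colourable_on G L S"
    unfolding colourable_on_def by (intro exI[of _ "d(v := c)"]) blast
  then show False using unc by simp
qed

text \<open>Double counting of the pairs of a vertex of \<open>S\<close> and a colour in its list:
  every colour in use occurs in at least two lists.\<close>

lemma uncolourable_few_colours:
  assumes "finite S" "\<And>v. v \<in> S \<Longrightarrow> finite (L v)" "\<And>v. v \<in> S \<Longrightarrow> card (L v) = k"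
  shows "2 * card (\<Union>v\<in>S. L v) \<le> k * card S"
proof -
  let ?U = "\<Union>v\<in>S. L v"
  have finU: "finite ?U" using assms by auto
  have two: "2 \<le> card {v \<in> S. c \<in> L v}" if c: "c \<in> ?U" for c
  proof -
    obtain v where v: "v \<in> S" "c \<in> L v" using c by blast
    obtain u where u: "u \<in> S - {v}" "c \<in> L u" using uncolourable_colour_repeated[OF v] by blast
    have "card {u, v} \<le> card {v \<in> S. c \<in> L v}" using u v assms(1) by (intro card_mono) auto
    then show ?thesis using u by simp
  qed
  have "2 * card ?U \<le> (\<Sum>c\<in>?U. card {v \<in> S. c \<in> L v})"
    using sum_mono[of ?U "\<lambda>_. 2", OF two] by (simp add: mult.commute)
  also have "\<dots> = (\<Sum>c\<in>?U. \<Sum>v\<in>S. if c \<in> L v then 1 else 0)"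
    using assms(1) by (intro sum.cong) (auto simp: sum.If_cases Int_def)
  also have "\<dots> = (\<Sum>v\<in>S. \<Sum>c\<in>?U. if c \<in> L v then 1 else 0)" by (rule sum.swap)
  also have "\<dots> = (\<Sum>v\<in>S. card (?U \<inter> L v))"
    using finU by (intro sum.cong) (auto simp: sum.If_cases)
  also have "\<dots> = (\<Sum>v\<in>S. k)"
  proof (intro sum.cong refl)
    fix v assume "v \<in> S"
    then have "?U \<inter> L v = L v" by auto
    then show "card (?U \<inter> L v) = k" using assms(3) \<open>v \<in> S\<close> by simp
  qed
  finally show ?thesis by (simp add: mult.commute)
qed

end

section \<open>Probability estimates for random lists\<close>

text \<open>Conditioning on all coordinates but \<open>u\<close>: neither \<open>Q\<close> nor the
  second argument of \<open>R\<close> depends on \<open>f u\<close>, so wherever \<open>Q\<close>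
  holds the fresh value at \<open>u\<close> satisfies \<open>R\<close> with probability at most
  \<open>c\<close>. Later \<open>u\<close> is a leaf of a tree.\<close>

lemma prob_insert_leaf:
  assumes A: "finite A" "u \<in> A"
    and Q: "\<And>f x. Q (f(u := x)) = Q f"
    and R: "\<And>f x. Q f \<Longrightarrow> measure_pmf.prob (p u) {x. R x f} \<le> c"
    and Ru: "\<And>f x y. R x (f(u := y)) = R x f"
    and c: "0 \<le> c"
  shows "measure_pmf.prob (Pi_pmf A d p) {f. Q f \<and> R (f u) f}
    \<le> c * measure_pmf.prob (Pi_pmf A d p) {f. Q f}"
proof -
  define B where "B = A - {u}"
  have B: "finite B" "u \<notin> B" "A = insert u B" using A by (auto simp: B_def)
  let ?P = "Pi_pmf B d p"
  \<comment> \<open>The coordinate \<open>u\<close> is drawn last.\<close>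
  have eq: "Pi_pmf A d p = ?P \<bind> (\<lambda>f. map_pmf (\<lambda>y. f(u := y)) (p u))"
    unfolding B(3) using B(1,2)
    by (simp add: Pi_pmf_insert' map_pmf_def bind_commute_pmf[of "p u"])
  have "emeasure (measure_pmf (Pi_pmf A d p)) {f. Q f \<and> R (f u) f}
      = (\<integral>\<^sup>+f. emeasure (measure_pmf (p u)) {x. Q f \<and> R x f} \<partial>?P)"
    unfolding eq by (simp add: Q Ru vimage_def)
  also have "\<dots> \<le> (\<integral>\<^sup>+f. ennreal c * indicator {f. Q f} f \<partial>?P)"
  proof (rule nn_integral_mono)
    fix f
    show "emeasure (measure_pmf (p u)) {x. Q f \<and> R x f} \<le> ennreal c * indicator {f. Q f} f"
      using R[of f] by (cases "Q f") (auto simp: measure_pmf.emeasure_eq_measure intro: ennreal_leI)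
  qed
  also have "\<dots> = ennreal c * emeasure (measure_pmf ?P) {f. Q f}"
    by (subst nn_integral_cmult) auto
  also have "emeasure (measure_pmf ?P) {f. Q f} = emeasure (measure_pmf (Pi_pmf A d p)) {f. Q f}"
  proof -
    have "emeasure (measure_pmf (Pi_pmf A d p)) {f. Q f}
      = (\<integral>\<^sup>+f. emeasure (measure_pmf (p u)) {x. Q f} \<partial>?P)"
      unfolding eq by (simp add: Q vimage_def)
    also have "\<dots> = (\<integral>\<^sup>+f. indicator {f. Q f} f \<partial>?P)"
      by (intro nn_integral_cong) (auto simp: indicator_def measure_pmf.emeasure_eq_measure)
    finally show ?thesis by simp
  qed
  finally show ?thesis
    using c by (simp add: measure_pmf.emeasure_eq_measure flip: ennreal_mult)
qed

section \<open>Random lists: one list, trees of conflicting edges, sets with few colours\<close>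

definition ksets :: "nat \<Rightarrow> nat \<Rightarrow> nat set set" where
  "ksets k m = {S. S \<subseteq> {1..m} \<and> card S = k}"

lemma ksets_finite_card: "finite (ksets k m)" "card (ksets k m) = m choose k"
  unfolding ksets_def by (auto simp: n_subsets)

lemma ksets_nonempty: "k \<le> m \<Longrightarrow> ksets k m \<noteq> {}"
  using ksets_finite_card(2)[of k m] by (metis card.empty zero_less_binomial less_irrefl)

lemma prob_ksets:
  assumes "k \<le> m"
  shows "measure_pmf.prob (pmf_of_set (ksets k m)) X = card (ksets k m \<inter> X) / (m choose k)"
  using measure_pmf_of_set[OF ksets_nonempty[OF assms] ksets_finite_card(1)]
  by (simp add: ksets_finite_card)

text \<open>The quotient of the two binomials is a product of factors
  \<open>(q - i) / (m - i)\<close>, each at most \<open>q / m\<close>. The form without division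
  also covers truncated subtraction.\<close>

lemma binomial_mult_power_le:
  fixes q m k :: nat
  assumes "q \<le> m"
  shows "(q choose k) * m ^ k \<le> (m choose k) * q ^ k"
proof (induction k)
  case (Suc k)
  have 1: "m * (q - k) \<le> q * (m - k)" using assms
    by (simp add: diff_mult_distrib2 mult.commute[of q m]) (metis diff_le_mono2 mult.commute mult_le_mono2)
  have bin: "Suc k * (n choose Suc k) = (n choose k) * (n - k)" for n
    by (metis binomial_absorb_comp mult.commute binomial_absorption)
  have "Suc k * ((q choose Suc k) * m ^ Suc k) = (Suc k * (q choose Suc k)) * m ^ Suc k"
    by (simp only: mult.assoc)
  also have "\<dots> = ((q choose k) * m ^ k) * (m * (q - k))"
    unfolding bin[of q] by (simp only: power_Suc mult_ac)
  also have "\<dots> \<le> ((m choose k) * q ^ k) * (q * (m - k))" using Suc 1 by (rule mult_le_mono)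
  also have "\<dots> = (Suc k * (m choose Suc k)) * q ^ Suc k"
    unfolding bin[of m] by (simp only: power_Suc mult_ac)
  also have "\<dots> = Suc k * ((m choose Suc k) * q ^ Suc k)" by (simp only: mult.assoc)
  finally show ?case by (meson Suc_mult_le_cancel1)
qed simp

lemma prob_kset_subset:
  assumes "k \<le> m" "0 < m" "B \<subseteq> {1..m}" "card B \<le> q"
  shows "measure_pmf.prob (pmf_of_set (ksets k m)) (Pow B) \<le> (real q / m) ^ k"
proof -
  have fB: "finite B" using assms(3) finite_subset by blast
  have bm: "card B \<le> m" using card_mono[OF _ assms(3)] by simp
  have "ksets k m \<inter> Pow B = {S. S \<subseteq> B \<and> card S = k}" using assms(3) unfolding ksets_def by auto
  then have "card (ksets k m \<inter> Pow B) = card B choose k" using n_subsets[OF fB] by simp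
  then have "measure_pmf.prob (pmf_of_set (ksets k m)) (Pow B)
      = real (card B choose k) / real (m choose k)" using prob_ksets[OF assms(1)] by simp
  also have "\<dots> \<le> (real (card B) / m) ^ k"
  proof -
    have "real (card B choose k) * real m ^ k \<le> real (m choose k) * real (card B) ^ k"
      using binomial_mult_power_le[OF bm, of k] by (metis of_nat_le_iff of_nat_mult of_nat_power)
    then show ?thesis using assms by (simp add: field_simps power_divide)
  qed
  also have "\<dots> \<le> (real q / m) ^ k" using assms by (intro power_mono divide_right_mono) auto
  finally show ?thesis .
qed

lemma prob_kset_member:
  assumes "k \<le> m" "0 < m"
  shows "measure_pmf.prob (pmf_of_set (ksets k m)) {S. b \<in> S} \<le> real k / m"
proof (cases "b \<in> {1..m} \<and> 0 < k")
  case True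
  \<comment> \<open>Deleting \<open>b\<close> is injective on the lists containing it; the
    absorption identity for binomials then turns the count into the ratio
    \<open>k / m\<close>.\<close>
  have "card (ksets k m \<inter> {S. b \<in> S}) \<le> (m - 1) choose (k - 1)"
  proof -
    have "inj_on (\<lambda>S. S - {b}) (ksets k m \<inter> {S. b \<in> S})" by (rule inj_onI) auto
    moreover have "(\<lambda>S. S - {b}) ` (ksets k m \<inter> {S. b \<in> S})
        \<subseteq> {S. S \<subseteq> {1..m} - {b} \<and> card S = k - 1}"
      unfolding ksets_def by (auto simp: card_Diff_singleton)
    moreover have "finite {S. S \<subseteq> {1..m} - {b} \<and> card S = k - 1}" by auto
    ultimately have "card (ksets k m \<inter> {S. b \<in> S}) \<le> card {S. S \<subseteq> {1..m} - {b} \<and> card S = k - 1}"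
      by (rule card_inj_on_le)
    then show ?thesis using True by (simp add: n_subsets)
  qed
  moreover have "k * (m choose k) = m * ((m - 1) choose (k - 1))"
    using True times_binomial_minus1_eq by blast
  ultimately have "card (ksets k m \<inter> {S. b \<in> S}) * m \<le> k * (m choose k)"
    by (simp add: mult.commute)
  then have "real (card (ksets k m \<inter> {S. b \<in> S})) * real m \<le> real k * real (m choose k)"
    by (metis of_nat_le_iff of_nat_mult)
  then show ?thesis unfolding prob_ksets[OF assms(1)] using assms by (simp add: field_simps)
next
  case False
  have "b \<notin> S" if "S \<in> ksets k m" for S
  proof
    assume b: "b \<in> S"
    have "finite S" using that finite_subset unfolding ksets_def by blast
    then show False using b that False unfolding ksets_def by (auto simp: card_gt_0_iff)
  qed
  then have "ksets k m \<inter> {S. b \<in> S} = {}" by auto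
  then show ?thesis unfolding prob_ksets[OF assms(1)] by simp
qed

lemma prob_kset_meets:
  assumes "k \<le> m" "0 < m" "finite B"
  shows "measure_pmf.prob (pmf_of_set (ksets k m)) {S. B \<inter> S \<noteq> {}} \<le> real (card B) * (real k / m)"
proof -
  have "{S. B \<inter> S \<noteq> {}} = (\<Union>b\<in>B. {S. b \<in> S})" by auto
  then have "measure_pmf.prob (pmf_of_set (ksets k m)) {S. B \<inter> S \<noteq> {}}
      \<le> (\<Sum>b\<in>B. measure_pmf.prob (pmf_of_set (ksets k m)) {S. b \<in> S})"
    using assms(3) by (simp add: measure_pmf.finite_measure_subadditive_finite)
  also have "\<dots> \<le> real (card B) * (real k / m)"
    using prob_kset_member[OF assms(1,2)] by (intro sum_bounded_above) auto
  finally show ?thesis .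
qed

text \<open>The child of the last edge is a leaf, so its list is independent of the earlier edges
  and meets the \<open>k\<close> colours of its parent with probability at most
  \<open>k * (k / m)\<close>. The size of \<open>L a\<close> is part of the event because the bound
  for the leaf must hold for every outcome of the other lists, not just almost surely.\<close>

lemma prob_tree_conflicts:
  assumes A: "finite A" and km: "k \<le> m" "0 < m" "0 < k"
  shows "attached X T \<Longrightarrow> snd ` set T \<subseteq> A \<Longrightarrow>
    measure_pmf.prob (Pi_pmf A {} (\<lambda>_. pmf_of_set (ksets k m)))
      {L. \<forall>(a, u)\<in>set T. card (L a) = k \<and> L a \<inter> L u \<noteq> {}} \<le> (real (k\<^sup>2) / m) ^ length T"
proof (induction T rule: rev_induct)
  case (snoc e T)
  obtain a u where e: "e = (a, u)" by (cases e)
  have att: "attached X T" "a \<in> X \<union> snd ` set T" "u \<notin> X \<union> snd ` set T"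
    using snoc.prems unfolding e attached_snoc by auto
  \<comment> \<open>The new child is no endpoint of an earlier edge, so the event for
    \<open>T\<close> ignores \<open>L u\<close>.\<close>
  have nu: "u \<noteq> b \<and> u \<noteq> w" if "(b, w) \<in> set T" for b w
    using att attached_parents[OF att(1)] that by force
  have ua: "a \<noteq> u" using att by auto
  let ?Q = "\<lambda>L :: nat \<Rightarrow> nat set. \<forall>(a, u)\<in>set T. card (L a) = k \<and> L a \<inter> L u \<noteq> {}"
  let ?P = "Pi_pmf A {} (\<lambda>_. pmf_of_set (ksets k m))"
  have "measure_pmf.prob ?P {L. ?Q L \<and> (card (L a) = k \<and> L a \<inter> L u \<noteq> {})}
      \<le> real (k\<^sup>2) / m * measure_pmf.prob ?P {L. ?Q L}"
  proof (rule prob_insert_leaf[where R = "\<lambda>x L. card (L a) = k \<and> L a \<inter> x \<noteq> {}"])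
    show "u \<in> A" using snoc.prems e by auto
    show "?Q (f(u := x)) = ?Q f" for f x using nu by fastforce
    show "measure_pmf.prob (pmf_of_set (ksets k m)) {x. card (L a) = k \<and> L a \<inter> x \<noteq> {}}
        \<le> real (k\<^sup>2) / m" for L
    proof (cases "card (L a) = k")
      case True
      then have "finite (L a)" using km by (intro card_ge_0_finite) simp
      from prob_kset_meets[OF km(1,2) this] True show ?thesis by (simp add: power2_eq_square)
    qed simp
  qed (use A ua in auto)
  also have "\<dots> \<le> real (k\<^sup>2) / m * (real (k\<^sup>2) / m) ^ length T"
    using snoc att by (intro mult_left_mono) auto
  also have "{L. ?Q L \<and> (card (L a) = k \<and> L a \<inter> L u \<noteq> {})}
      = {L. \<forall>(a, u)\<in>set (T @ [e]). card (L a) = k \<and> L a \<inter> L u \<noteq> {}}"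
    unfolding e by auto
  finally show ?case by simp
qed simp

text \<open>Union bound over the \<open>m ^ q\<close> maps \<open>f\<close> from
  \<open>{..<q}\<close> to the colours: at most \<open>q\<close> colours in use lie in the image of
  such a map, and a single list falls into a fixed image with probability at most
  \<open>(q / m) ^ k\<close>.\<close>

lemma prob_few_colours:
  assumes A: "finite A" and km: "k \<le> m" "0 < m" and S: "S \<subseteq> A" "q = k * card S div 2"
  shows "measure_pmf.prob (Pi_pmf A {} (\<lambda>_. pmf_of_set (ksets k m)))
      {L. (\<forall>v\<in>S. L v \<subseteq> {1..m}) \<and> 2 * card (\<Union>v\<in>S. L v) \<le> k * card S}
    \<le> real m ^ q * (real q / m) ^ (k * card S)" (is "measure_pmf.prob ?P ?E \<le> _")
proof -
  let ?F = "{f. f \<in> {..<q} \<rightarrow>\<^sub>E {1..m}}"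
  have finF: "finite ?F" by (simp add: finite_PiE)
  have sub: "?E \<subseteq> (\<Union>f\<in>?F. Pi A (\<lambda>v. if v \<in> S then Pow (f ` {..<q}) else UNIV))"
  proof
    fix L assume L: "L \<in> ?E"
    let ?U = "\<Union>v\<in>S. L v"
    have U: "?U \<subseteq> {1..m}" "card ?U \<le> q" using L S(2) by auto
    then have finU: "finite ?U" using finite_subset by blast
    obtain h where h: "h ` {..<card ?U} = ?U"
      using ex_bij_betw_nat_finite[OF finU] by (auto simp: bij_betw_def atLeast0LessThan)
    \<comment> \<open>An enumeration of the used colours, padded with colour \<open>1\<close> up to
      length \<open>q\<close>; \<open>0 < m\<close> makes \<open>1\<close> a legal colour.\<close>
    define f where "f = restrict (\<lambda>i. if i < card ?U then h i else 1) {..<q}"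
    have "h i \<in> {1..m}" if "i < card ?U" for i using h U(1) that by blast
    then have "f \<in> ?F" using km unfolding f_def by auto
    moreover have "?U \<subseteq> f ` {..<q}"
    proof
      fix c assume "c \<in> ?U"
      then obtain i where "i < card ?U" "c = h i" using h by (metis imageE lessThan_iff)
      then show "c \<in> f ` {..<q}" using U(2) unfolding f_def by (intro image_eqI[of _ _ i]) auto
    qed
    ultimately show "L \<in> (\<Union>f\<in>?F. Pi A (\<lambda>v. if v \<in> S then Pow (f ` {..<q}) else UNIV))"
      by (intro UN_I[of f]) (auto simp: SUP_le_iff)
  qed
  have "measure_pmf.prob ?P ?E
      \<le> measure_pmf.prob ?P (\<Union>f\<in>?F. Pi A (\<lambda>v. if v \<in> S then Pow (f ` {..<q}) else UNIV))"
    using sub by (intro measure_pmf.finite_measure_mono) auto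
  also have "\<dots> \<le> (\<Sum>f\<in>?F. measure_pmf.prob ?P (Pi A (\<lambda>v. if v \<in> S then Pow (f ` {..<q}) else UNIV)))"
    using finF by (intro measure_pmf.finite_measure_subadditive_finite) auto
  also have "\<dots> \<le> (\<Sum>f\<in>?F. (real q / m) ^ (k * card S))"
  proof (rule sum_mono)
    fix f assume f: "f \<in> ?F"
    have fim: "f ` {..<q} \<subseteq> {1..m}" "card (f ` {..<q}) \<le> q"
      using f card_image_le[of "{..<q}" f] by auto
    have "measure_pmf.prob ?P (Pi A (\<lambda>v. if v \<in> S then Pow (f ` {..<q}) else UNIV))
      = (\<Prod>v\<in>A. measure_pmf.prob (pmf_of_set (ksets k m)) (if v \<in> S then Pow (f ` {..<q}) else UNIV))"
      by (rule measure_Pi_pmf_Pi[OF A])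
    also have "\<dots> \<le> (\<Prod>v\<in>A. if v \<in> S then (real q / m) ^ k else 1)"
      using prob_kset_subset[OF km fim] by (intro prod_mono) auto
    also have "\<dots> = (real q / m) ^ (k * card S)"
      using A S(1) by (simp add: prod.If_cases Int_absorb1 power_mult)
    finally show "measure_pmf.prob ?P (Pi A (\<lambda>v. if v \<in> S then Pow (f ` {..<q}) else UNIV))
      \<le> (real q / m) ^ (k * card S)" .
  qed
  also have "\<dots> = real m ^ q * (real q / m) ^ (k * card S)"
    by (simp add: card_PiE)
  finally show ?thesis .
qed

section \<open>Degrees and the union bound over rooted trees\<close>

lemma neighbours_subset:
  assumes "sgraph G"
  shows "{w. {w, u} \<in> snd G} \<subseteq> fst G"
proof
  fix w assume "w \<in> {w. {w, u} \<in> snd G}"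
  then show "w \<in> fst G" using assms unfolding sgraph_def by (auto dest!: bspec simp: doubleton_eq_iff)
qed

lemma degree_le_max_degree:
  assumes "sgraph G"
  shows "degree G u \<le> max_degree G"
proof (cases "u \<in> fst G")
  case True
  then show ?thesis using assms unfolding max_degree_def sgraph_def by (auto intro!: Max_ge)
next
  case False
  \<comment> \<open>Naturals outside the vertex set have no neighbours, so the bound holds for every
    \<open>u\<close>, as \<open>card_grow\<close> demands.\<close>
  have "{w. {w, u} \<in> snd G} = {}"
    using neighbours_subset[OF assms] False by (auto simp: insert_commute)
  then show ?thesis by (simp add: degree_def)
qed

text \<open>The first term covers minimal uncolourable sets with more than \<open>M\<close>
  vertices, the sum those with \<open>Suc r \<le> M\<close> vertices. The factor
  \<open>card (fst G)\<close> counts roots, the binomials bound the trees at a fixed root.\<close>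

lemma prob_not_colourable_le:
  fixes k g m M d :: nat
  assumes G: "sgraph G" "H_free \<H> G" "good_bound \<H> k g"
    and km: "0 < k" "k \<le> m"
    and d: "max_degree G = d"
  shows "1 - prob_colourable G k m \<le>
    card (fst G) * (real ((d + d * M) choose M) * (real (k\<^sup>2) / m) ^ M) +
    (\<Sum>r\<in>{g..<M}. card (fst G) * (real ((d + d * r) choose r) *
       (real m ^ (k * Suc r div 2) * (real (k * Suc r div 2) / m) ^ (k * Suc r))))"
proof -
  define V where "V = fst G"
  define nb where "nb u = sorted_list_of_set {w. {w, u} \<in> snd G}" for u
  \<comment> \<open>Trees with \<open>r\<close> edges, hence \<open>Suc r\<close> vertices. The
    edges at the root are pending at the start, which accounts for the summand \<open>d\<close> in
    \<open>d + d * r\<close>.\<close>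
  define Tr where "Tr r v = grow nb r {v} (map (Pair v) (nb v))" for r v
  define E1 where "E1 T = {L :: nat \<Rightarrow> nat set. \<forall>(a, u)\<in>set T. card (L a) = k \<and> L a \<inter> L u \<noteq> {}}"
    for T :: "(nat \<times> nat) list"
  define E2 where "E2 S = {L :: nat \<Rightarrow> nat set. (\<forall>v\<in>S. L v \<subseteq> {1..m}) \<and>
    2 * card (\<Union>v\<in>S. L v) \<le> k * card S}" for S
  define P where "P = random_lists G k m"
  have P: "P = Pi_pmf V {} (\<lambda>_. pmf_of_set (ksets k m))"
    by (simp add: P_def random_lists_def V_def ksets_def)
  have m0: "0 < m" using km by simp
  have finV: "finite V" using G(1) by (simp add: V_def sgraph_def)
  have nbset: "set (nb u) = {w. {w, u} \<in> snd G}" for u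
    using neighbours_subset[OF G(1)] finV unfolding nb_def V_def
    by (intro set_sorted_list_of_set) (rule finite_subset)
  have nbV: "set (nb u) \<subseteq> V" for u using nbset neighbours_subset[OF G(1)] V_def by simp
  have len: "length (nb u) \<le> d" for u
    using degree_le_max_degree[OF G(1), of u] unfolding nb_def d degree_def by simp
  have Tr_fin: "finite (Tr r v)" for r v
    unfolding Tr_def using card_grow[of nb, OF len] by blast
  have Tr_card: "card (Tr r v) \<le> (d + d * r) choose r" for r v
  proof -
    have "card (Tr r v) \<le> (length (map (Pair v) (nb v)) + d * r) choose r"
      unfolding Tr_def using card_grow[of nb, OF len] by blast
    also have "\<dots> \<le> (d + d * r) choose r" using len[of v] by (intro binomial_right_mono) simp
    finally show ?thesis .
  qed
  have Tr_att: "attached {v} T" "length T = r" "snd ` set T \<subseteq> V" if "T \<in> Tr r v" for T r v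
  proof -
    have T: "T \<in> grow nb r {v} (map (Pair v) (nb v))" using that unfolding Tr_def .
    show "attached {v} T" by (rule attached_grow[OF T]) auto
    show "length T = r" by (rule length_grow[OF T])
    show "snd ` set T \<subseteq> V"
      by (rule grow_children_subset[of nb V, OF nbV T]) (use nbV[of v] in auto)
  qed
  have Tr_cardset: "card (insert v (snd ` set T)) = Suc r" if "T \<in> Tr r v" for T r v
    using attached_children[OF Tr_att(1)[OF that]] Tr_att(2)[OF that] by simp
  let ?B1 = "\<Union>v\<in>V. \<Union>T\<in>Tr M v. E1 T"
  let ?B2 = "\<Union>r\<in>{g..<M}. \<Union>v\<in>V. \<Union>T\<in>Tr r v. E2 (insert v (snd ` set T))"
  \<comment> \<open>Restricting to the support makes every list on \<open>V\<close> a
    \<open>k\<close>-subset of the colours.\<close>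
  have cover: "{L. \<not> L_colourable G L} \<inter> set_pmf P \<subseteq> ?B1 \<union> ?B2"
  proof
    fix L assume L: "L \<in> {L. \<not> L_colourable G L} \<inter> set_pmf P"
    have Lv: "L v \<subseteq> {1..m} \<and> card (L v) = k" if "v \<in> V" for v
    proof -
      have "L v \<in> set_pmf (pmf_of_set (ksets k m))"
        using L that unfolding P by (auto simp: set_Pi_pmf[OF finV] PiE_dflt_def)
      then show ?thesis
        using set_pmf_of_set[OF ksets_nonempty[OF km(2)] ksets_finite_card(1)] by (simp add: ksets_def)
    qed
    obtain S where S: "S \<subseteq> V" and unc: "\<not> colourable_on G L S"
      and min: "\<And>X. X \<subset> S \<Longrightarrow> colourable_on G L X"
      using minimal_uncolourable[OF G(1)] L unfolding V_def by blast
    have gS: "g < card S"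
      using colourable_on_small[OF G, of S L] S Lv unc unfolding V_def by (meson not_le_imp_less)
    have finS: "finite S" using S finV finite_subset by blast
    obtain v where v: "v \<in> S" using gS by fastforce
    have ex: "\<exists>T\<in>Tr r v. (\<forall>(a, u)\<in>set T. conflict G L a u) \<and> snd ` set T \<subseteq> S"
      if r: "Suc r \<le> card S" for r
      unfolding Tr_def
    proof (rule grow_exists[OF finS])
      show "\<exists>a\<in>Y. \<exists>b\<in>S - Y. conflict G L a b" if "Y \<subset> S" "Y \<noteq> {}" for Y
        using uncolourable_connected[OF unc min that] .
      show "b \<in> set (nb a)" if "conflict G L a b" for a b
        using that unfolding nbset conflict_def by (simp add: insert_commute)
      show "\<forall>a\<in>{v}. \<forall>b\<in>S - {v}. conflict G L a b \<longrightarrow> (a, b) \<in> set (map (Pair v) (nb v))"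
        unfolding conflict_def using nbset by (auto simp: insert_commute)
    qed (use v r in auto)
    show "L \<in> ?B1 \<union> ?B2"
    proof (cases "Suc M \<le> card S")
      case True
      from ex[OF this] obtain T where T: "T \<in> Tr M v" "\<forall>(a, u)\<in>set T. conflict G L a u"
        "snd ` set T \<subseteq> S" by blast
      have "fst ` set T \<subseteq> V" using attached_parents[OF Tr_att(1)[OF T(1)]] T(3) v S by auto
      then have "L \<in> E1 T" using T(2) Lv unfolding E1_def conflict_def by fastforce
      then show ?thesis using T(1) v S by blast
    next
      case False
      \<comment> \<open>A spanning tree has one edge fewer than \<open>S\<close> has vertices, so
        \<open>g < card S \<le> M\<close> becomes \<open>g \<le> r < M\<close>.\<close>
      define r where "r = card S - 1"
      have r: "Suc r = card S" "r \<in> {g..<M}" using gS False unfolding r_def by auto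
      from ex[of r] r obtain T where T: "T \<in> Tr r v" "snd ` set T \<subseteq> S" by auto
      have "insert v (snd ` set T) = S"
        using Tr_cardset[OF T(1)] r(1) T(2) v by (intro card_subset_eq[OF finS]) auto
      moreover have "2 * card (\<Union>v\<in>S. L v) \<le> k * card S"
      proof (rule uncolourable_few_colours[OF unc min finS])
        show "finite (L v)" if "v \<in> S" for v
          using that S Lv finite_subset[of "L v" "{1..m}"] by auto
        show "card (L v) = k" if "v \<in> S" for v using that S Lv by blast
      qed
      ultimately have "L \<in> E2 (insert v (snd ` set T))" using Lv S unfolding E2_def by auto
      then show ?thesis using r(2) v S T(1) by blast
    qed
  qed
  have p1: "measure_pmf.prob P ?B1
      \<le> card V * (real ((d + d * M) choose M) * (real (k\<^sup>2) / m) ^ M)"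
  proof -
    have "measure_pmf.prob P ?B1 \<le> (\<Sum>v\<in>V. measure_pmf.prob P (\<Union>T\<in>Tr M v. E1 T))"
      using finV by (intro measure_pmf.finite_measure_subadditive_finite) auto
    also have "\<dots> \<le> (\<Sum>v\<in>V. \<Sum>T\<in>Tr M v. measure_pmf.prob P (E1 T))"
      using Tr_fin by (intro sum_mono measure_pmf.finite_measure_subadditive_finite) auto
    also have "\<dots> \<le> (\<Sum>v\<in>V. \<Sum>T\<in>Tr M v. (real (k\<^sup>2) / m) ^ M)"
    proof (intro sum_mono)
      fix v T assume T: "T \<in> Tr M v"
      from prob_tree_conflicts[OF finV km(2) m0 km(1) Tr_att(1)[OF T] Tr_att(3)[OF T]]
      show "measure_pmf.prob P (E1 T) \<le> (real (k\<^sup>2) / m) ^ M"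
        unfolding P E1_def Tr_att(2)[OF T] .
    qed
    also have "\<dots> \<le> (\<Sum>v\<in>V. real ((d + d * M) choose M) * (real (k\<^sup>2) / m) ^ M)"
      using Tr_card
      by (intro sum_mono order_trans[OF eq_refl[OF sum_constant]] mult_right_mono of_nat_mono) auto
    finally show ?thesis by simp
  qed
  have p2: "measure_pmf.prob P ?B2 \<le> (\<Sum>r\<in>{g..<M}. card V * (real ((d + d * r) choose r) *
       (real m ^ (k * Suc r div 2) * (real (k * Suc r div 2) / m) ^ (k * Suc r))))"
  proof -
    let ?c = "\<lambda>r. real m ^ (k * Suc r div 2) * (real (k * Suc r div 2) / m) ^ (k * Suc r)"
    let ?S = "\<lambda>v T. insert v (snd ` set T)"
    have one: "measure_pmf.prob P (E2 (?S v T)) \<le> ?c r" if "v \<in> V" "T \<in> Tr r v" for v T r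
    proof -
      have "?S v T \<subseteq> V" using that Tr_att(3) by auto
      from prob_few_colours[OF finV km(2) m0 this refl] show ?thesis
        unfolding P E2_def Tr_cardset[OF that(2)] .
    qed
    have "measure_pmf.prob P ?B2
        \<le> (\<Sum>r\<in>{g..<M}. measure_pmf.prob P (\<Union>v\<in>V. \<Union>T\<in>Tr r v. E2 (?S v T)))"
      by (intro measure_pmf.finite_measure_subadditive_finite) auto
    also have "\<dots> \<le> (\<Sum>r\<in>{g..<M}. \<Sum>v\<in>V. measure_pmf.prob P (\<Union>T\<in>Tr r v. E2 (?S v T)))"
      using finV by (intro sum_mono measure_pmf.finite_measure_subadditive_finite) auto
    also have "\<dots> \<le> (\<Sum>r\<in>{g..<M}. \<Sum>v\<in>V. \<Sum>T\<in>Tr r v. measure_pmf.prob P (E2 (?S v T)))"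
      using Tr_fin by (intro sum_mono measure_pmf.finite_measure_subadditive_finite) auto
    also have "\<dots> \<le> (\<Sum>r\<in>{g..<M}. \<Sum>v\<in>V. \<Sum>T\<in>Tr r v. ?c r)"
      using one by (intro sum_mono) auto
    also have "\<dots> \<le> (\<Sum>r\<in>{g..<M}. \<Sum>v\<in>V. real ((d + d * r) choose r) * ?c r)"
      using Tr_card
      by (intro sum_mono order_trans[OF eq_refl[OF sum_constant]] mult_right_mono of_nat_mono) auto
    finally show ?thesis by simp
  qed
  have "1 - prob_colourable G k m = measure_pmf.prob P (UNIV - {L. L_colourable G L})"
    unfolding prob_colourable_def P_def
    using measure_pmf.prob_compl[of "{L. L_colourable G L}" "random_lists G k m"] by simp
  also have "\<dots> = measure_pmf.prob P ({L. \<not> L_colourable G L} \<inter> set_pmf P)"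
    by (subst measure_Int_set_pmf) (simp add: Collect_neg_eq Compl_eq_Diff_UNIV)
  also have "\<dots> \<le> measure_pmf.prob P (?B1 \<union> ?B2)"
    using cover by (intro measure_pmf.finite_measure_mono) auto
  also have "\<dots> \<le> measure_pmf.prob P ?B1 + measure_pmf.prob P ?B2"
    by (intro measure_Un_le) auto
  finally show ?thesis using p1 p2 unfolding V_def by linarith
qed

text \<open>Degree zero is a separate case: for \<open>g > 0\<close> the lower bound on
  \<open>m\<close> then degenerates to zero. Without edges any choice from the nonempty lists is
  proper.\<close>

lemma prob_colourable_edgeless:
  assumes "sgraph G" "max_degree G = 0" "0 < k" "k \<le> m"
  shows "prob_colourable G k m = 1"
proof -
  have finV: "finite (fst G)" using assms(1) by (simp add: sgraph_def)
  have noedge: "{u, v} \<notin> snd G" for u v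
  proof
    assume "{u, v} \<in> snd G"
    then have "0 < degree G v" unfolding degree_def
      using neighbours_subset[OF assms(1), of v] finV by (auto simp: card_gt_0_iff intro: finite_subset)
    then show False using degree_le_max_degree[OF assms(1), of v] assms(2) by simp
  qed
  have "L_colourable G L" if L: "L \<in> set_pmf (random_lists G k m)" for L
  proof -
    have "\<exists>c. c \<in> L v" if "v \<in> fst G" for v
    proof -
      have "L v \<in> set_pmf (pmf_of_set (ksets k m))"
        using L that by (auto simp: random_lists_def ksets_def set_Pi_pmf[OF finV] PiE_dflt_def)
      then have "card (L v) = k"
        using set_pmf_of_set[OF ksets_nonempty[OF assms(4)] ksets_finite_card(1)]
        by (simp add: ksets_def)
      then have "L v \<noteq> {}" using assms(3) by (metis card.empty less_irrefl)
      then show ?thesis by blast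
    qed
    then have "\<forall>v\<in>fst G. (SOME c. c \<in> L v) \<in> L v" using someI_ex by fast
    then show ?thesis unfolding L_colourable_def proper_colouring_def using noedge
      by (intro exI[of _ "\<lambda>v. SOME c. c \<in> L v"]) blast
  qed
  then show ?thesis unfolding prob_colourable_def
    by (intro measure_pmf.prob_eq_1[THEN iffD2]) (auto simp: AE_measure_pmf_iff)
qed

section \<open>Asymptotics\<close>

text \<open>One term of the series of \<open>exp (Suc M)\<close>, with a common factor
  \<open>Suc M\<close> cancelled.\<close>

lemma power_Suc_le_fact_exp: "real (Suc M) ^ M \<le> fact M * exp (real (Suc M))"
proof -
  have "real (Suc M) ^ Suc M / fact (Suc M) \<le> exp (real (Suc M))"
  proof -
    have "(\<Sum>i\<in>{Suc M}. real (Suc M) ^ i /\<^sub>R fact i) \<le> (\<Sum>i. real (Suc M) ^ i /\<^sub>R fact i)"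
      by (intro sum_le_suminf summable_exp_generic) auto
    then show ?thesis by (simp add: exp_def divide_inverse mult.commute)
  qed
  moreover have "real (Suc M) ^ Suc M / fact (Suc M) = real (Suc M) ^ M / fact M"
    by (simp only: power_Suc fact_Suc of_nat_mult mult_divide_mult_cancel_left_if) simp
  ultimately show ?thesis by (simp add: divide_le_eq mult.commute)
qed

text \<open>The binomial is at most \<open>(d * Suc M) ^ M / fact M\<close>, hence at most
  \<open>d ^ M * exp (Suc M)\<close>, and \<open>d * k\<^sup>2 / m \<le> 1 / 3\<close>. The constant
  \<open>3\<close> in the hypothesis matters because it exceeds \<open>exp 1\<close>.\<close>

lemma long_tree_term_le:
  fixes k m d M :: nat
  assumes "0 < m" "3 * k\<^sup>2 * d \<le> m"
  shows "real ((d + d * M) choose M) * (real (k\<^sup>2) / m) ^ M \<le> exp 1 * (exp 1 / 3) ^ M"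
proof -
  have "real ((d + d * M) choose M) * fact M \<le> real ((d + d * M) ^ M)"
    using binomial_fact_pow[of "d + d * M" M] by (metis of_nat_fact of_nat_le_iff of_nat_mult)
  also have "real ((d + d * M) ^ M) = real d ^ M * real (Suc M) ^ M"
    by (simp add: power_mult_distrib[symmetric] algebra_simps)
  also have "\<dots> \<le> real d ^ M * (fact M * exp (real (Suc M)))"
    by (intro mult_left_mono power_Suc_le_fact_exp) simp
  finally have 1: "real ((d + d * M) choose M) \<le> real d ^ M * exp (real (Suc M))"
    by (simp add: mult.left_commute mult.commute[of _ "fact M"])
  have 2: "real d * (real (k\<^sup>2) / m) \<le> 1 / 3"
  proof -
    have "real (3 * k\<^sup>2 * d) \<le> real m" using assms(2) by (simp only: of_nat_le_iff)
    then show ?thesis using assms(1) by (simp add: field_simps)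
  qed
  have "real ((d + d * M) choose M) * (real (k\<^sup>2) / m) ^ M
      \<le> real d ^ M * exp (real (Suc M)) * (real (k\<^sup>2) / m) ^ M"
    using 1 by (intro mult_right_mono) auto
  also have "\<dots> = exp (real (Suc M)) * (real d * (real (k\<^sup>2) / m)) ^ M"
    by (simp only: power_mult_distrib mult_ac)
  also have "\<dots> \<le> exp (real (Suc M)) * (1 / 3) ^ M"
    using 2 by (intro mult_left_mono power_mono) auto
  also have "exp (real (Suc M)) = exp 1 * exp 1 ^ M"
    by (simp add: exp_of_nat_mult[symmetric] exp_add[symmetric])
  finally show ?thesis by (simp add: power_divide)
qed

text \<open>Compared with \<open>r = g\<close>, each further vertex costs a factor \<open>d / m powr (k/2) \<le> m powr (-1/2)\<close>,
  which beats the polylogarithmic factor \<open>(k * (g + 1 + M)) ^ ((k + 1) * (g + 2))\<close>.\<close>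

lemma few_colours_term_le:
  fixes k m d r n g M :: nat and \<delta> :: real
  assumes k: "3 \<le> k" and m: "0 < m" "d \<le> m" and r: "g \<le> r" "r < M" and \<delta>: "0 \<le> \<delta>"
    and x: "real n * real d ^ g \<le> \<delta> * (real m powr (k / 2)) ^ Suc g"
    and y: "real m powr (-1/2) * real (k * (g + 1 + M)) ^ ((k + 1) * (g + 2)) \<le> 1 / 2"
  shows "real n * (real ((d + d * r) choose r) *
       (real m ^ (k * Suc r div 2) * (real (k * Suc r div 2) / m) ^ (k * Suc r)))
    \<le> \<delta> * (real (k * (g + 1)) ^ ((k + 1) * (g + 1)) + 1) * (1 / 2) ^ (r - g)"
proof -
  define N where "N = Suc r"
  define q where "q = k * N div 2"
  define w where "w = real m powr (k / 2)"
  define y where "y = real m powr (-1/2)"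
  define j where "j = r - g"
  have w: "0 < w" using m by (simp add: w_def)
  have y0: "0 \<le> y" by (simp add: y_def)
  have N: "1 \<le> N" "N = g + 1 + j" "j < M" using r by (auto simp: N_def j_def)
  \<comment> \<open>Each vertex accounts for one factor \<open>w\<close>: choosing the colours costs
    at most \<open>w ^ N\<close>, while placing the lists among them gains
    \<open>w ^ N * w ^ N\<close>.\<close>
  have mq: "real m ^ q \<le> w ^ N"
  proof -
    have "real m ^ q = real m powr (real q)" using m by (simp add: powr_realpow)
    also have "\<dots> \<le> real m powr (k * N / 2)"
      using m of_nat_div_le_of_nat[of "k * N" 2, where ?'a = real] by (intro powr_mono) (auto simp: q_def)
    also have "\<dots> = w ^ N" using m by (simp add: w_def powr_power mult.commute)
    finally show ?thesis .
  qed
  have mkN: "real m ^ (k * N) = w ^ N * w ^ N"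
  proof -
    have "w ^ N * w ^ N = real m powr (real (k * N))"
      using m by (simp add: w_def powr_power powr_add[symmetric] mult.commute)
    then show ?thesis using m by (simp only: powr_realpow of_nat_0_less_iff)
  qed
  have "real m ^ q * (real q / m) ^ (k * N) \<le> w ^ N * (real q ^ (k * N) / (w ^ N * w ^ N))"
    unfolding power_divide mkN using mq w by (intro mult_right_mono) auto
  also have "\<dots> = real q ^ (k * N) / w ^ N" using w by simp
  also have "\<dots> \<le> real (k * N) ^ (k * N) / w ^ N"
    using w unfolding q_def
    by (intro divide_right_mono power_mono of_nat_mono div_le_dividend) auto
  finally have 1: "real m ^ q * (real q / m) ^ (k * N) \<le> real (k * N) ^ (k * N) / w ^ N" .
  have 2: "real ((d + d * r) choose r) \<le> real d ^ r * real (k * N) ^ N"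
  proof -
    have "(d + d * r) choose r \<le> (d + d * r) ^ r"
      by (metis binomial_fact_pow fact_ge_1 le_trans mult_le_mono2 mult.right_neutral)
    also have "\<dots> = d ^ r * N ^ r" by (simp add: N_def power_mult_distrib[symmetric] algebra_simps)
    also have "\<dots> \<le> d ^ r * (k * N) ^ N"
    proof (rule mult_le_mono2)
      have "N ^ r \<le> (k * N) ^ r" using k by (intro power_mono) auto
      also have "\<dots> \<le> (k * N) ^ N" using k N by (intro power_increasing) (auto simp: N_def)
      finally show "N ^ r \<le> (k * N) ^ N" .
    qed
    finally show ?thesis by (metis of_nat_le_iff of_nat_mult of_nat_power)
  qed
  \<comment> \<open>Here \<open>k \<ge> 3\<close> enters: \<open>1 \<le> k / 2 - 1 / 2\<close>,
    together with \<open>d \<le> m\<close>.\<close>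
  have dw: "real d / w \<le> y"
  proof -
    have "real d \<le> real m powr 1" using m by simp
    also have "\<dots> \<le> real m powr (k / 2 - 1 / 2)" using k m by (intro powr_mono) auto
    also have "\<dots> = y * w" unfolding y_def w_def by (simp add: powr_add[symmetric])
    finally show ?thesis using w by (simp add: field_simps)
  qed
  have xx: "real n * real d ^ g / w ^ Suc g \<le> \<delta>"
    using x w unfolding w_def[symmetric] by (simp add: field_simps)
  let ?K = "real (k * N) ^ ((k + 1) * N)"
  have "real n * (real ((d + d * r) choose r) * (real m ^ q * (real q / m) ^ (k * N)))
      \<le> real n * ((real d ^ r * real (k * N) ^ N) * (real (k * N) ^ (k * N) / w ^ N))"
    using 1 2 by (intro mult_left_mono mult_mono) auto
  also have "\<dots> = (real n * real d ^ g / w ^ Suc g) * (real d / w) ^ j * ?K"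
  proof -
    have "r = g + j" "N = Suc g + j" using N by (auto simp: N_def)
    then have dr: "real d ^ r = real d ^ g * real d ^ j" and wN: "w ^ N = w ^ Suc g * w ^ j"
      by (simp_all only: power_add)
    have K: "?K = real (k * N) ^ N * real (k * N) ^ (k * N)"
      by (simp add: power_add[symmetric] algebra_simps)
    show ?thesis unfolding dr wN K power_divide by simp
  qed
  also have "\<dots> \<le> \<delta> * y ^ j * ?K"
    using xx dw \<delta> y0 w by (intro mult_right_mono mult_mono power_mono) auto
  also have "\<dots> = \<delta> * (y ^ j * ?K)" by simp
  \<comment> \<open>For \<open>j = 0\<close> the factor \<open>?K\<close> is the fixed power with
    \<open>N = g + 1\<close>. For \<open>j > 0\<close>, \<open>N \<le> (g + 2) * j\<close> bounds
    \<open>?K\<close> by a \<open>j\<close>-th power that \<open>y ^ j\<close> absorbs; the summand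
    \<open>1\<close> in the constant serves this case.\<close>
  also have "y ^ j * ?K \<le> (real (k * (g + 1)) ^ ((k + 1) * (g + 1)) + 1) * (1 / 2) ^ j"
  proof (cases "j = 0")
    case False
    have "N \<le> (g + 2) * j" using False N(2) by (cases j) auto
    then have e: "(k + 1) * N \<le> ((k + 1) * (g + 2)) * j" by (metis mult.assoc mult_le_mono2)
    have "?K \<le> real (k * (g + 1 + M)) ^ ((k + 1) * N)"
      using N by (intro power_mono of_nat_mono mult_le_mono) auto
    also have "\<dots> \<le> real (k * (g + 1 + M)) ^ (((k + 1) * (g + 2)) * j)"
    proof (rule power_increasing[OF e])
      have "1 \<le> k * (g + 1 + M)" using k by simp
      then show "1 \<le> real (k * (g + 1 + M))" by (rule order_trans[OF _ of_nat_mono, rotated]) simp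
    qed
    finally have "y ^ j * ?K \<le> (y * real (k * (g + 1 + M)) ^ ((k + 1) * (g + 2))) ^ j"
      unfolding power_mult_distrib power_mult[symmetric] using y0 by (intro mult_left_mono) auto
    also have "\<dots> \<le> (1 / 2) ^ j" using assms(8) y0 unfolding y_def by (intro power_mono) auto
    also have "\<dots> \<le> (real (k * (g + 1)) ^ ((k + 1) * (g + 1)) + 1) * (1 / 2) ^ j" by simp
    finally show ?thesis .
  qed (simp add: N)
  finally show ?thesis
    using \<delta> unfolding N_def[symmetric] q_def[symmetric] j_def[symmetric] mult.assoc
    by (simp only: mult_left_mono)
qed

lemma sum_half_powers_le: "(\<Sum>r\<in>{g..<M}. (1 / 2 :: real) ^ (r - g)) \<le> 2"
proof -
  have "(\<Sum>r\<in>{g..<M}. (1 / 2 :: real) ^ (r - g)) = (\<Sum>j<M - g. (1 / 2) ^ j)"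
    by (rule sum.reindex_bij_witness[of _ "\<lambda>j. j + g" "\<lambda>r. r - g"]) auto
  also have "\<dots> = (1 - (1 / 2) ^ (M - g)) / (1 - 1 / 2)" by (subst sum_gp_strict) auto
  also have "\<dots> \<le> 2" by simp
  finally show ?thesis .
qed

text \<open>The square of the logarithm grows fast enough that a fixed base below 1 raised to it
  beats the factor \<open>n\<close>, yet powers of it stay negligible against any positive power of
  \<open>n\<close>.\<close>

definition cutoff :: "nat \<Rightarrow> nat" where "cutoff n = nat \<lceil>(ln (real n))\<^sup>2\<rceil>"

lemma LIMSEQ_0_le:
  fixes f h :: "nat \<Rightarrow> real"
  assumes "h \<longlonglongrightarrow> 0" "\<And>n. f n \<le> h n" "\<And>n. 0 \<le> f n"
  shows "f \<longlonglongrightarrow> 0"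
  by (rule tendsto_sandwich[OF _ _ tendsto_const assms(1)]) (use assms(2,3) in auto)

text \<open>The base is \<open>exp (- b)\<close> with \<open>b = ln 3 - 1 > 0\<close>, and
  \<open>exp (- b * (ln n)\<^sup>2)\<close> decays faster than any power of
  \<open>n\<close>.\<close>

lemma long_tree_term_tendsto: "(\<lambda>n. real n * (exp 1 / 3) ^ cutoff n) \<longlonglongrightarrow> 0"
proof -
  define b :: real where "b = ln 3 - 1"
  have "exp 1 < (3 :: real)" using e_less_272 by simp
  then have b: "0 < b" unfolding b_def using ln_less_cancel_iff[of "exp 1" 3] by simp
  have e3: "exp 1 / 3 = exp (- b)" unfolding b_def by (simp add: exp_diff)
  have "(\<lambda>n. real n * exp (- b * (ln (real n))\<^sup>2)) \<longlonglongrightarrow> 0" using b by real_asymp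
  moreover have "real n * (exp 1 / 3) ^ cutoff n \<le> real n * exp (- b * (ln (real n))\<^sup>2)" for n
  proof -
    have "(ln (real n))\<^sup>2 \<le> real (cutoff n)" unfolding cutoff_def by linarith
    then have "b * (ln (real n))\<^sup>2 \<le> b * real (cutoff n)" using b by simp
    then show ?thesis unfolding e3 exp_of_nat_mult[symmetric]
      by (intro mult_left_mono) (auto simp: mult.commute)
  qed
  ultimately show ?thesis by (rule LIMSEQ_0_le) simp
qed

lemma polylog_powr_tendsto:
  fixes p :: real
  assumes "0 < p"
  shows "(\<lambda>n. real n powr (- p) * real (k * (g + 1 + cutoff n)) ^ P) \<longlonglongrightarrow> 0"
proof -
  have "(\<lambda>n. real n powr (- p) * (real k * (real g + 2 + (ln (real n))\<^sup>2)) ^ P) \<longlonglongrightarrow> 0"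
  proof (cases "P = 0 \<or> k = 0")
    case True
    have "(\<lambda>n. real n powr (- p) * c) \<longlonglongrightarrow> 0" for c using assms by real_asymp
    moreover have "real n powr (- p) * (real k * (real g + 2 + (ln (real n))\<^sup>2)) ^ P
       = real n powr (- p) * (0 ^ P)" for n using True by (auto simp: power_0_left)
    ultimately show ?thesis by (simp only:)
  next
    case False
    then have "0 < real k" "0 < real P" by auto
    \<comment> \<open>Each of the \<open>P\<close> factors receives the share
      \<open>n powr (- p / P)\<close> of the decay, so it suffices that the base tends to
      zero.\<close>
    have "(\<lambda>n. real n powr (- p / P) * (real k * (real g + 2 + (ln (real n))\<^sup>2))) \<longlonglongrightarrow> 0"
      using assms \<open>0 < real k\<close> \<open>0 < real P\<close> by real_asymp
    then have "(\<lambda>n. (real n powr (- p / P) * (real k * (real g + 2 + (ln (real n))\<^sup>2))) ^ P) \<longlonglongrightarrow> 0 ^ P"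
      by (rule tendsto_power)
    moreover have "(real n powr (- p / P)) ^ P = real n powr (- p)" for n
      using False by (cases "n = 0") (simp_all add: powr_power)
    ultimately show ?thesis using False by (simp add: power_mult_distrib zero_power)
  qed
  moreover have "real n powr (- p) * real (k * (g + 1 + cutoff n)) ^ P
      \<le> real n powr (- p) * (real k * (real g + 2 + (ln (real n))\<^sup>2)) ^ P" for n
  proof -
    have "real (cutoff n) \<le> 1 + (ln (real n))\<^sup>2"
      unfolding cutoff_def using zero_le_power2[of "ln (real n)"] by linarith
    then have "real (k * (g + 1 + cutoff n)) \<le> real k * (real g + 2 + (ln (real n))\<^sup>2)"
      unfolding of_nat_mult by (intro mult_left_mono) auto
    then show ?thesis by (intro mult_left_mono power_mono) auto
  qed
  ultimately show ?thesis by (rule LIMSEQ_0_le) simp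
qed

text \<open>The estimate for a single graph, with \<open>\<delta>\<close> measuring how far
  \<open>m\<close> exceeds the threshold: the terms over \<open>r\<close> are dominated by a
  geometric series of sum at most 2.\<close>

lemma prob_not_colourable_le_explicit:
  fixes k g m M :: nat and \<delta> :: real
  assumes G: "sgraph G" "H_free \<H> G" "good_bound \<H> k g"
    and k: "3 \<le> k" "k \<le> m" and m: "3 * k\<^sup>2 * max_degree G \<le> m" and \<delta>: "0 \<le> \<delta>"
    and x: "real (card (fst G)) * real (max_degree G) ^ g \<le> \<delta> * (real m powr (k / 2)) ^ Suc g"
    and y: "real m powr (-1/2) * real (k * (g + 1 + M)) ^ ((k + 1) * (g + 2)) \<le> 1 / 2"
  shows "1 - prob_colourable G k m \<le> exp 1 * (real (card (fst G)) * (exp 1 / 3) ^ M) +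
    2 * \<delta> * (real (k * (g + 1)) ^ ((k + 1) * (g + 1)) + 1)"
proof -
  define n d where "n = card (fst G)" and "d = max_degree G"
  let ?c = "real (k * (g + 1)) ^ ((k + 1) * (g + 1)) + 1"
  have "1 * d \<le> (3 * k\<^sup>2) * d" using k by (intro mult_le_mono1) auto
  then have dm: "d \<le> m" using m unfolding d_def by linarith
  have m0: "0 < m" "0 < k" using k by auto
  have "1 - prob_colourable G k m \<le>
    real n * (real ((d + d * M) choose M) * (real (k\<^sup>2) / m) ^ M) +
    (\<Sum>r\<in>{g..<M}. real n * (real ((d + d * r) choose r) *
       (real m ^ (k * Suc r div 2) * (real (k * Suc r div 2) / m) ^ (k * Suc r))))"
    using prob_not_colourable_le[OF G m0(2) k(2) d_def[symmetric], of M] unfolding n_def .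
  also have "\<dots> \<le> real n * (exp 1 * (exp 1 / 3) ^ M) + (\<Sum>r\<in>{g..<M}. \<delta> * ?c * (1 / 2) ^ (r - g))"
  proof (intro add_mono sum_mono)
    show "real n * (real ((d + d * M) choose M) * (real (k\<^sup>2) / m) ^ M)
      \<le> real n * (exp 1 * (exp 1 / 3) ^ M)"
      using m by (intro mult_left_mono long_tree_term_le m0) (auto simp: d_def)
    show "real n * (real ((d + d * r) choose r) *
       (real m ^ (k * Suc r div 2) * (real (k * Suc r div 2) / m) ^ (k * Suc r)))
      \<le> \<delta> * ?c * (1 / 2) ^ (r - g)" if "r \<in> {g..<M}" for r
      using that x y by (intro few_colours_term_le[OF k(1) m0(1) dm _ _ \<delta>]) (auto simp: n_def d_def)
  qed
  also have "(\<Sum>r\<in>{g..<M}. \<delta> * ?c * (1 / 2) ^ (r - g)) = \<delta> * ?c * (\<Sum>r\<in>{g..<M}. (1 / 2) ^ (r - g))"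
    by (simp only: sum_distrib_left)
  also have "\<dots> \<le> \<delta> * ?c * 2" using \<delta> by (intro mult_left_mono sum_half_powers_le) auto
  finally show ?thesis by (simp add: n_def algebra_simps)
qed

theorem mainTheorem2:
  fixes k g :: nat and \<H> :: "graph set" and G :: "nat \<Rightarrow> graph" and m :: "nat \<Rightarrow> nat"
  assumes "k \<ge> 3"
    and "is_g \<H> k g"
    and "\<And>n. sgraph (G n) \<and> fst (G n) = {..<n} \<and> H_free \<H> (G n)"
    and "\<And>n. 0 < m n \<and> k \<le> m n"
    and "\<And>C::real. eventually (\<lambda>n. C * (real n powr (2 / (k * (g + 1))) *
            rpow (real (max_degree (G n))) (2 * g / (k * (g + 1)))) \<le> real (m n)) sequentially"
    and "\<And>n. m n \<ge> 3 * k^2 * max_degree (G n)"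
  shows "(\<lambda>n. prob_colourable (G n) k (m n)) \<longlonglongrightarrow> 1"
proof (rule tendstoI)
  fix \<epsilon> :: real assume \<epsilon>: "0 < \<epsilon>"
  have gb: "good_bound \<H> k g" using assms(2) by (simp add: is_g_def)
  define c where "c = real (k * (g + 1)) ^ ((k + 1) * (g + 1)) + 1"
  have c: "0 < c" unfolding c_def by (intro add_nonneg_pos) auto
  \<comment> \<open>Makes the contribution \<open>2 * \<delta> * c\<close> of the small sets equal
    to \<open>\<epsilon> / 4\<close>; the long trees get \<open>\<epsilon> / 2\<close>.\<close>
  define \<delta> where "\<delta> = \<epsilon> / (8 * c)"
  have \<delta>: "0 < \<delta>" using \<epsilon> c by (simp add: \<delta>_def)
  \<comment> \<open>The exponents of \<open>n\<close> and of the degree in the growth assumption are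
    \<open>1 / s\<close> and \<open>g / s\<close>, so raising to the power \<open>s\<close> yields
    \<open>n * d ^ g\<close>.\<close>
  define s where "s = real (k * (g + 1)) / 2"
  have s: "0 < s" using assms(1) unfolding s_def of_nat_mult by (intro divide_pos_pos mult_pos_pos) auto
  have "(\<lambda>n. exp 1 * (real n * (exp 1 / 3) ^ cutoff n)) \<longlonglongrightarrow> exp 1 * 0"
    by (intro tendsto_intros long_tree_term_tendsto)
  then have ev1: "\<forall>\<^sub>F n in sequentially. exp 1 * (real n * (exp 1 / 3) ^ cutoff n) < \<epsilon> / 2"
    using \<epsilon> by (intro order_tendstoD(2)[where y = "exp 1 * 0"]) auto
  have ev2: "\<forall>\<^sub>F n in sequentially. real n powr (- (1 / (2 * s))) *
      real (k * (g + 1 + cutoff n)) ^ ((k + 1) * (g + 2)) < 1 / 2"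
    using s by (intro order_tendstoD(2)[OF polylog_powr_tendsto]) auto
  \<comment> \<open>For positive degree \<open>d\<close>, the growth assumption with constant
    \<open>1\<close> gives \<open>n powr (1 / s) \<le> m\<close>, and with
    \<open>(1 / \<delta>) powr (1 / s)\<close> it gives
    \<open>n * d ^ g \<le> \<delta> * m powr s\<close>.\<close>
  show "\<forall>\<^sub>F n in sequentially. dist (prob_colourable (G n) k (m n)) 1 < \<epsilon>"
    using ev1 ev2 assms(5)[of 1] assms(5)[of "(1 / \<delta>) powr (1 / s)"] eventually_gt_at_top[of 0]
  proof eventually_elim
    case (elim n)
    define d where "d = max_degree (G n)"
    have Gn: "sgraph (G n)" "H_free \<H> (G n)" "card (fst (G n)) = n" using assms(3)[of n] by auto
    have mn: "0 < m n" "k \<le> m n" using assms(4)[of n] by auto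
    have "1 - prob_colourable (G n) k (m n) < \<epsilon>"
    proof (cases "d = 0")
      case True
      then show ?thesis using prob_colourable_edgeless[of "G n" k "m n"] Gn mn assms(1) \<epsilon>
        by (simp add: d_def)
    next
      case False
      have exps: "2 / real (k * (g + 1)) = 1 / s" "real (2 * g) / real (k * (g + 1)) = real g / s"
        by (simp_all add: s_def)
      have rp: "rpow (real d) (real g / s) = real d powr (real g / s)"
        using False by (simp add: rpow_def)
      have lb: "C * (real n powr (1 / s) * real d powr (real g / s)) \<le> real (m n)"
        if "C * (real n powr (2 / (k * (g + 1))) *
            rpow (real (max_degree (G n))) (2 * g / (k * (g + 1)))) \<le> real (m n)" for C
        using that unfolding exps d_def[symmetric] rp .
      have "(1 / \<delta>) * (real n * real d ^ g) \<le> real (m n) powr s"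
      proof -
        have "(((1 / \<delta>) powr (1 / s)) * (real n powr (1 / s) * real d powr (real g / s))) powr s
            \<le> real (m n) powr s"
          using lb[OF elim(4)] s by (intro powr_mono2) auto
        then show ?thesis using s \<delta> elim(5) False
          by (simp add: powr_mult powr_powr powr_realpow)
      qed
      then have x: "real n * real d ^ g \<le> \<delta> * (real (m n) powr (k / 2)) ^ Suc g"
      proof -
        have "(real (m n) powr (k / 2)) ^ Suc g = real (m n) powr s"
          using mn(1) unfolding s_def by (subst powr_power) (auto simp: algebra_simps)
        then show ?thesis using \<open>(1 / \<delta>) * _ \<le> _\<close> \<delta> by (simp only:) (simp add: field_simps)
      qed
      have "real n powr (1 / s) \<le> real (m n)"
      proof -
        have "1 \<le> real d powr (real g / s)" using False s by (intro ge_one_powr_ge_zero) auto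
        then have "real n powr (1 / s) * 1 \<le> real n powr (1 / s) * real d powr (real g / s)"
          by (intro mult_left_mono) auto
        then show ?thesis using lb[OF elim(3)] by simp
      qed
      \<comment> \<open>The decay in \<open>m\<close> becomes decay in \<open>n\<close>, where it
        can be compared with the polylogarithmic factor.\<close>
      then have "real (m n) powr (-1/2) \<le> (real n powr (1 / s)) powr (-1/2)"
        using elim(5) by (intro powr_mono2') auto
      also have "\<dots> = real n powr (- (1 / (2 * s)))"
        unfolding powr_powr by (simp add: mult.commute)
      finally have "real (m n) powr (-1/2) * real (k * (g + 1 + cutoff n)) ^ ((k + 1) * (g + 2))
          \<le> real n powr (- (1 / (2 * s))) * real (k * (g + 1 + cutoff n)) ^ ((k + 1) * (g + 2))"
        by (intro mult_right_mono) auto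
      then have y: "real (m n) powr (-1/2) *
          real (k * (g + 1 + cutoff n)) ^ ((k + 1) * (g + 2)) \<le> 1 / 2"
        using elim(2) by linarith
      have "1 - prob_colourable (G n) k (m n)
          \<le> exp 1 * (real n * (exp 1 / 3) ^ cutoff n) + 2 * \<delta> * c"
        using prob_not_colourable_le_explicit[OF Gn(1,2) gb assms(1) mn(2) assms(6) less_imp_le[OF \<delta>] _ y]
          x unfolding Gn(3) d_def c_def by blast
      also have "2 * \<delta> * c = \<epsilon> / 4" using c by (simp add: \<delta>_def)
      finally show ?thesis using elim(1) \<epsilon> by linarith
    qed
    moreover have "prob_colourable (G n) k (m n) \<le> 1" by (simp add: prob_colourable_def)
    ultimately show ?case by (simp add: dist_real_def)
  qed
qed

end
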